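(* Let $G=([n],E)$ be a directed graph and $\mathcal{S}_G=\langle\mathrm{E}_{i,j}\mid (i,j)\in E\rangle\le\mathrm{M}(n,\mathbb{C})$. The maximum number of vertices in an acyclic induced subgraph of $G$ equals the largest dimension of a subspace $U\le\mathbb{C}^n$ such that $\mathcal{S}_G[U]$ is nil.
   Context: Directed graphs have arc sets $E\subseteq[n]\times[n]$, self-loops allowed and counted as cycles; acyclic means no directed cycle. For $S\subseteq[n]$, the induced subgraph $G[S]$ has vertex set $S$ and arcs $E\cap(S\times S)$. $\mathrm{E}_{i,j}$ is the elementary matrix with $1$ at $(i,j)$. For $\mathcal{S}\le\mathrm{M}(n,\mathbb{C})$ and a $d$-dimensional subspace $U\le\mathbb{C}^n$, let $T_U$ be a $d\times n$ matrix whose rows form an orthonormal basis of $U$; the induced subspace is $\mathcal{S}[U]=\{T_UBT_U^*\mid B\in\mathcal{S}\}\le\mathrm{M}(d,\mathbb{C})$ (well defined up to unitary conjugation). A matrix space is nil if all its elements are nilpotent. *)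

theory Defs
  imports "Jordan_Normal_Form.Schur_Decomposition"
begin

text \<open>Directed graphs on n vertices have vertex set \<open>{..<n}\<close>, matching the 0-based indices of
  matrices. Loops are allowed, and \<^const>\<open>acyclic\<close> counts them as cycles.\<close>

definition induced_arcs :: "(nat \<times> nat) set \<Rightarrow> nat set \<Rightarrow> (nat \<times> nat) set" where
  "induced_arcs E S = E \<inter> (S \<times> S)"

definition elementary_mat :: "nat \<Rightarrow> nat \<Rightarrow> nat \<Rightarrow> complex mat" where
  "elementary_mat n i j = mat n n (\<lambda>(a, b). if a = i \<and> b = j then 1 else 0)"

definition graph_mat_space :: "nat \<Rightarrow> (nat \<times> nat) set \<Rightarrow> complex mat set" where
  "graph_mat_space n E =
     LinearCombinations.module.span class_ring (module_mat TYPE(complex) n n)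
       {elementary_mat n i j | i j. (i, j) \<in> E}"

abbreviation complex_subspace :: "nat \<Rightarrow> complex vec set \<Rightarrow> bool" where
  "complex_subspace n U \<equiv> VectorSpace.subspace class_ring U (module_vec TYPE(complex) n)"

abbreviation subspace_vs :: "nat \<Rightarrow> complex vec set \<Rightarrow> (complex, complex vec) module" where
  "subspace_vs n U \<equiv> module_vec TYPE(complex) n \<lparr>carrier := U\<rparr>"

abbreviation subspace_dim :: "nat \<Rightarrow> complex vec set \<Rightarrow> nat" where
  "subspace_dim n U \<equiv> vectorspace.dim class_ring (subspace_vs n U)"

definition orthonormal_list :: "complex vec list \<Rightarrow> bool" where
  "orthonormal_list us \<longleftrightarrow>
     (\<forall>i < length us. \<forall>j < length us. us ! i \<bullet>c us ! j = (if i = j then 1 else 0))"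

definition orthonormal_basis_mat :: "nat \<Rightarrow> complex vec set \<Rightarrow> complex mat \<Rightarrow> bool" where
  "orthonormal_basis_mat n U T \<longleftrightarrow>
     T \<in> carrier_mat (subspace_dim n U) n \<and>
     vectorspace.basis class_ring (subspace_vs n U) (set (rows T)) \<and>
     orthonormal_list (rows T)"

context
  fixes n :: nat
begin

interpretation cof_vec_space n "TYPE(complex)" .

lemma orthonormal_list_corthogonal: "orthonormal_list us \<Longrightarrow> corthogonal us" unfolding orthonormal_list_def by (intro corthogonalI) auto

lemma orthonormal_list_lin_indpt: assumes "orthonormal_list us" "set us \<subseteq> carrier_vec n" shows "lin_indpt (set us)"
proof
  assume "lin_dep (set us)"
  then obtain A a v where A: "finite A" "A \<subseteq> set us" "lincomb a A = 0\<^sub>v n" "v \<in> A" "a v \<noteq> 0"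
    unfolding lin_dep_def by auto
  have c: "A \<subseteq> carrier_vec n" using A assms by auto
  have v: "v \<in> carrier_vec n" "conjugate v \<in> carrier_vec n" using A c by auto
  have g: "(\<lambda>u. a u \<cdot>\<^sub>v u) : A \<rightarrow> carrier_vec n" using c by auto
  have "0 = lincomb a A \<bullet>c v" using A v by simp
  also have "\<dots> = (\<Sum>u\<in>A. (a u \<cdot>\<^sub>v u) \<bullet>c v)"
    unfolding lincomb_def using finsum_scalar_prod_sum[OF g v(2)] by simp
  also have "\<dots> = (\<Sum>u\<in>A. a u * (u \<bullet>c v))"
    by (rule sum.cong, use c v in auto)
  also have "\<dots> = (\<Sum>u\<in>A. if u = v then a v else 0)"
  proof (rule sum.cong, goal_cases)
    case (2 u)
    from 2 A obtain i j where "i < length us" "u = us!i" "j < length us" "v = us!j"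
      by (metis in_set_conv_nth subsetD)
    with assms(1) corthogonal_distinct[OF orthonormal_list_corthogonal[OF assms(1)]] show ?case unfolding orthonormal_list_def by (auto simp: nth_eq_iff_index_eq)
  qed simp
  also have "\<dots> = a v" using A by simp
  finally show False using A by simp
qed

lemma orthonormal_basis_mat_exists:
  assumes "complex_subspace n U"
  shows "\<exists>T. orthonormal_basis_mat n U T"
proof -
  have sm: "submodule class_ring U V" using assms unfolding subspace_def by auto
  have Uc: "U \<subseteq> carrier_vec n" using sm unfolding submodule_def by auto
  define P where "P us \<longleftrightarrow> set us \<subseteq> U \<and> orthonormal_list us" for us
  have b: "length us \<le> n" if "P us" for us
  proof -
    have c: "set us \<subseteq> carrier_vec n" using that Uc P_def by auto
    have "card (set us) \<le> dim" by (rule li_le_dim(2)) (use orthonormal_list_lin_indpt c that P_def in auto)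
    then show ?thesis using that P_def corthogonal_distinct[OF orthonormal_list_corthogonal] by (auto simp: distinct_card dim_is_n)
  qed
  have "P []" by (auto simp: P_def orthonormal_list_def)
  then obtain us where us: "P us" and mx: "\<And>vs. P vs \<Longrightarrow> length vs \<le> length us"
  proof -
    have "\<exists>x. P x \<and> (\<forall>y. P y \<longrightarrow> length y \<le> length x)"
      by (rule ex_has_greatest_nat[of P "[]" length "Suc n"]) (use b \<open>P []\<close> in \<open>auto simp: less_Suc_eq_le\<close>)
    then show ?thesis using that by (elim exE conjE) simp
  qed
  have c: "set us \<subseteq> carrier_vec n" and on: "orthonormal_list us" using us Uc P_def by auto
  have d: "distinct us" using on orthonormal_list_corthogonal corthogonal_distinct by auto
  have sub: "span (set us) \<subseteq> U" by (rule span_is_subset) (use us P_def sm in auto)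
  have sp: "span (set us) = U"
  proof (rule ccontr)
    assume "span (set us) \<noteq> U"
    then obtain w where w: "w \<in> U" "w \<notin> span (set us)" using sub by auto
    have wc: "w \<in> carrier_vec n" using w Uc by auto
    define x where "x = adjuster n w us + w"
    have xU: "x \<in> U" unfolding x_def
      using adjuster_in_span[OF wc c d] sub w submodule.m_closed[OF sm, of "adjuster n w us" w] by auto
    have xc: "x \<in> carrier_vec n" using xU Uc by auto
    have x0: "x \<noteq> 0\<^sub>v n" unfolding x_def by (rule adjust_nonzero[OF c d wc w(2)])
    have xo: "x \<bullet>c us!i = 0" if "i < length us" for i
      unfolding x_def by (rule adjust_zero[OF c orthonormal_list_corthogonal[OF on] wc that])
    have ox: "us!i \<bullet>c x = 0" if "i < length us" for i
    proof -
      have "us!i \<in> carrier_vec n" using c that by auto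
      then have "us!i \<bullet>c x = conjugate (x \<bullet>c us!i)"
        using xc by (metis conjugate_conjugate_sprod conjugate_vec_sprod_comm)
      then show ?thesis using xo[OF that] by simp
    qed
    have pos: "x \<bullet>c x > 0" using conjugate_square_greater_0_vec[OF xc] x0 by auto
    define r where "r = Re (x \<bullet>c x)"
    have r: "x \<bullet>c x = of_real r" "r > 0" using pos by (auto simp: r_def complex_eq_iff less_complex_def)
    define s :: complex where "s = of_real (1 / sqrt r)"
    have ss: "s * (s * of_real r) = 1" using r(2) unfolding s_def
      by (simp flip: of_real_mult add: real_divide_square_eq)
    define y where "y = s \<cdot>\<^sub>v x"
    have yU: "y \<in> U" unfolding y_def using submodule.smult_closed[OF sm, of s x] xU by auto
    have cs: "conjugate s = s" by (simp add: s_def)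
    have cy: "conjugate y = s \<cdot>\<^sub>v conjugate x" unfolding y_def
      by (metis conjugate_smult_vec cs)
    have yy: "y \<bullet>c y = 1" unfolding cy using xc ss r by (simp add: y_def)
    have yo: "y \<bullet>c us!i = 0" if "i < length us" for i
    proof -
      have "us!i \<in> carrier_vec n" using c that by auto
      then show ?thesis using xo[OF that] xc by (simp add: y_def)
    qed
    have oy: "us!i \<bullet>c y = 0" if "i < length us" for i
    proof -
      have "us!i \<in> carrier_vec n" using c that by auto
      then show ?thesis unfolding cy using ox[OF that] xc by simp
    qed
    have "P (us @ [y])" unfolding P_def
    proof
      show "set (us @ [y]) \<subseteq> U" using us yU P_def by auto
      show "orthonormal_list (us @ [y])" using on yo oy yy unfolding orthonormal_list_def by (auto simp: nth_append less_Suc_eq)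
    qed
    from mx[OF this] show False by simp
  qed
  interpret W: vectorspace class_ring "vs U" using subspace_is_vs assms by auto
  have bas: "W.basis (set us)" unfolding W.basis_def
    using span_li_not_depend[OF _ sm, of "set us"] sp us P_def orthonormal_list_lin_indpt[OF on c] by auto
  have dm: "W.dim = length us" using W.dim_basis[OF _ bas] d by (simp add: distinct_card)
  show ?thesis
    apply (rule exI[of _ "mat_of_rows n us"])
    unfolding orthonormal_basis_mat_def
    using bas dm c on unfolding orthonormal_list_def by (auto simp: subset_iff mat_of_rows_row)
qed

end

text \<open>A choice of the matrix \<open>T\<^sub>U\<close>. It exists by the lemma above, and any two such
  matrices differ by a unitary factor on the left, so which one is chosen affects the induced
  subspace below only up to unitary conjugation.\<close>

definition onb_mat :: "nat \<Rightarrow> complex vec set \<Rightarrow> complex mat" where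
  "onb_mat n U = (SOME T. orthonormal_basis_mat n U T)"

definition induced_subspace :: "nat \<Rightarrow> complex mat set \<Rightarrow> complex vec set \<Rightarrow> complex mat set" where
  "induced_subspace n \<S> U = {onb_mat n U * B * mat_adjoint (onb_mat n U) | B. B \<in> \<S>}"

definition nilpotent_mat :: "complex mat \<Rightarrow> bool" where
  "nilpotent_mat A \<longleftrightarrow> square_mat A \<and> (\<exists>k. A ^\<^sub>m k = 0\<^sub>m (dim_row A) (dim_row A))"

definition nil_mat_space :: "complex mat set \<Rightarrow> bool" where
  "nil_mat_space \<S> \<longleftrightarrow> (\<forall>A \<in> \<S>. nilpotent_mat A)"

end

theory Submission
  imports Defs
begin

text \<open>If \<open>G[S]\<close> is acyclic, take for \<open>U\<close> the span of the unit vectors indexed by \<open>S\<close>. Then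
  \<open>T\<^sup>* T\<close> is the coordinate projection onto \<open>S\<close>, so column \<open>j\<close> of \<open>(T B T\<^sup>*)\<^sup>m T\<close> vanishes once \<open>m\<close>
  exceeds the length of every walk of \<open>G[S]\<close> ending in \<open>j\<close>.

  Conversely, let \<open>U\<close> have dimension \<open>d\<close> and choose \<open>d\<close> linearly independent columns of \<open>T\<close>, indexed by
  \<open>S\<close>. If \<open>G[S]\<close> had a cycle, it would contain a nonempty set \<open>D\<close> permuted along arcs by some \<open>f\<close>; let
  \<open>X\<close> be the sum of the \<open>E\<^sub>i\<^sub>,\<^sub>f\<^sub>i\<close> with \<open>i \<in> D\<close>. On the column space of \<open>T\<^sub>D\<close> the matrix
  \<open>T X T\<^sup>*\<close> acts as \<open>T\<^sub>D a \<mapsto> T\<^sub>D X\<^sub>D (T\<^sub>D\<^sup>* T\<^sub>D) a\<close>, which is injective because the Gram matrix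
  \<open>T\<^sub>D\<^sup>* T\<^sub>D\<close> is positive definite, so \<open>T X T\<^sup>*\<close> is not nilpotent.\<close>

section \<open>Matrix entries, and the matrix space of a graph\<close>

lemma index_mult_mat_sum:
  assumes "A \<in> carrier_mat nr n" "B \<in> carrier_mat n nc" "i < nr" "j < nc"
  shows "(A * B) $$ (i, j) = (\<Sum>k<n. A $$ (i, k) * B $$ (k, j))"
  using assms by (auto simp: scalar_prod_def atLeast0LessThan intro!: sum.cong)

lemma index_mult_mat_vec_sum:
  assumes "A \<in> carrier_mat nr n" "v \<in> carrier_vec n" "i < nr"
  shows "(A *\<^sub>v v) $ i = (\<Sum>k<n. A $$ (i, k) * v $ k)"
  using assms by (auto simp: scalar_prod_def atLeast0LessThan intro!: sum.cong)

lemma mat_adjoint_carrier [simp]: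
  "A \<in> carrier_mat nr nc \<Longrightarrow> mat_adjoint A \<in> carrier_mat nc nr"
  unfolding mat_adjoint_def by auto

lemma index_mat_adjoint:
  assumes "A \<in> carrier_mat nr nc" "i < nc" "j < nr"
  shows "mat_adjoint A $$ (i, j) = conjugate (A $$ (j, i))"
  using assms unfolding mat_adjoint_def by (auto simp: mat_of_rows_def)

text \<open>The right-hand side is a submodule containing the generators, so it contains the span.
  Conversely, a matrix supported on \<open>E\<close> is assembled from its entries.\<close>

lemma graph_mat_space_eq:
  assumes E: "E \<subseteq> {..<n} \<times> {..<n}"
  shows "graph_mat_space n E =
    {B \<in> carrier_mat n n. \<forall>i<n. \<forall>j<n. (i, j) \<notin> E \<longrightarrow> B $$ (i, j) = 0}" (is "_ = ?R")
proof -
  interpret matrix_vs n n "TYPE(complex)" .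
  let ?G = "{elementary_mat n i j | i j. (i, j) \<in> E}"
  have G: "?G \<subseteq> carrier_mat n n" by (auto simp: elementary_mat_def)
  have sm: "submodule class_ring ?R V"
    by unfold_locales (auto simp: matrix_vs_simps)
  have "span ?G \<subseteq> ?R"
    by (rule span_is_subset[OF _ sm]) (auto simp: elementary_mat_def)
  moreover have "B \<in> span ?G" if B: "B \<in> ?R" for B
  proof -
    have sp: "submodule class_ring (span ?G) V" by (rule span_is_submodule[OF G])
    \<comment> \<open>\<open>B\<close> cut down to a finite set of arcs is in the span: each new arc
      adds one scaled elementary matrix. \<open>F = E\<close> then gives \<open>B\<close>
      itself.\<close>
    have "mat n n (\<lambda>p. if p \<in> F then B $$ p else 0) \<in> span ?G" if "finite F" "F \<subseteq> E" for F
      using that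
    proof (induction F)
      case empty
      have "mat n n (\<lambda>p. 0) = (0\<^sub>m n n :: complex mat)" by auto
      then show ?case using submodule.zero_closed[OF sp] by (simp add: matrix_vs_simps)
    next
      case (insert p F)
      obtain i j where p: "p = (i, j)" by (cases p)
      have "elementary_mat n i j \<in> span ?G"
        using in_own_span[OF G] insert.prems p by blast
      then have "B $$ p \<cdot>\<^sub>m elementary_mat n i j \<in> span ?G"
        using submodule.smult_closed[OF sp, of "B $$ p"] by (simp add: matrix_vs_simps)
      then have "mat n n (\<lambda>p. if p \<in> F then B $$ p else 0) + B $$ p \<cdot>\<^sub>m elementary_mat n i j \<in> span ?G"
        using submodule.m_closed[OF sp] insert by (simp add: matrix_vs_simps)
      moreover have "mat n n (\<lambda>p. if p \<in> F then B $$ p else 0) + B $$ p \<cdot>\<^sub>m elementary_mat n i j =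
          mat n n (\<lambda>q. if q \<in> insert p F then B $$ q else 0)"
        by (rule eq_matI) (use insert.hyps p in \<open>auto simp: elementary_mat_def\<close>)
      ultimately show ?case by simp
    qed
    moreover have "finite E" using E by (rule finite_subset) auto
    ultimately have "mat n n (\<lambda>p. if p \<in> E then B $$ p else 0) \<in> span ?G" by blast
    moreover have "mat n n (\<lambda>p. if p \<in> E then B $$ p else 0) = B"
      by (rule eq_matI) (use B in auto)
    ultimately show ?thesis by simp
  qed
  ultimately show ?thesis unfolding graph_mat_space_def by blast
qed

section \<open>Orthonormal basis matrices and independent columns\<close>

lemma onb_mat_orthonormal_basis:
  "complex_subspace n U \<Longrightarrow> orthonormal_basis_mat n U (onb_mat n U)"
  unfolding onb_mat_def by (rule someI_ex) (rule orthonormal_basis_mat_exists)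

lemma orthonormal_basis_mat_coisometry:
  assumes "orthonormal_basis_mat n U T"
  shows "T * mat_adjoint T = 1\<^sub>m (subspace_dim n U)"
proof -
  let ?d = "subspace_dim n U"
  have T: "T \<in> carrier_mat ?d n" and on: "orthonormal_list (rows T)"
    using assms unfolding orthonormal_basis_mat_def by auto
  show ?thesis
  proof (rule eq_matI)
    fix i j assume "i < dim_row (1\<^sub>m ?d)" "j < dim_col (1\<^sub>m ?d)"
    then have ij: "i < ?d" "j < ?d" by auto
    have "(T * mat_adjoint T) $$ (i, j) = row T i \<bullet>c row T j"
      using ij T mat_adjoint_carrier[OF T] unfolding mat_adjoint_def
      by (auto simp: scalar_prod_def mat_of_rows_def intro!: sum.cong)
    also have "\<dots> = 1\<^sub>m ?d $$ (i, j)" using on ij T unfolding orthonormal_list_def by auto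
    finally show "(T * mat_adjoint T) $$ (i, j) = 1\<^sub>m ?d $$ (i, j)" .
  qed (use carrier_matD[OF T] carrier_matD[OF mat_adjoint_carrier[OF T]] in auto)
qed

text \<open>Both sides are the trace, of \<open>B * A\<close> and of \<open>A * B\<close> respectively.\<close>

lemma card_eq_of_right_inverse:
  fixes A B :: "complex mat"
  assumes A: "A \<in> carrier_mat d n" and B: "B \<in> carrier_mat n d" and AB: "A * B = 1\<^sub>m d"
    and S: "S \<subseteq> {..<n}" and diag: "\<And>i. i < n \<Longrightarrow> (B * A) $$ (i, i) = (if i \<in> S then 1 else 0)"
  shows "card S = d"
proof -
  have "of_nat d = (\<Sum>a<d. (A * B) $$ (a, a))" using AB by simp
  also have "\<dots> = (\<Sum>a<d. \<Sum>i<n. A $$ (a, i) * B $$ (i, a))"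
    by (intro sum.cong) (auto simp: index_mult_mat_sum[OF A B])
  also have "\<dots> = (\<Sum>i<n. \<Sum>a<d. B $$ (i, a) * A $$ (a, i))"
    by (subst sum.swap) (simp add: mult.commute)
  also have "\<dots> = (\<Sum>i<n. (B * A) $$ (i, i))"
    by (intro sum.cong) (auto simp: index_mult_mat_sum[OF B A])
  also have "\<dots> = (\<Sum>i<n. if i \<in> S then 1 else 0)" by (intro sum.cong) (auto simp: diag)
  also have "\<dots> = (\<Sum>i\<in>{..<n} \<inter> S. 1)" by (subst sum.inter_restrict) auto
  also have "\<dots> = of_nat (card S)" using S by (simp add: Int_absorb1)
  finally show ?thesis by (metis of_nat_eq_iff)
qed

text \<open>\<open>S\<close> is a minimal set of columns for which \<open>T\<close> still has a right inverse \<open>Y\<close>. Minimality makes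
  these columns independent, so that \<open>Y * T\<close> fixes every vector supported on \<open>S\<close>.\<close>

lemma independent_columns_of_right_inverse:
  fixes T X :: "complex mat"
  assumes T: "T \<in> carrier_mat d n" and X: "X \<in> carrier_mat n d" and TX: "T * X = 1\<^sub>m d"
  obtains S where "S \<subseteq> {..<n}" "card S = d"
    "\<And>x. \<lbrakk>x \<in> carrier_vec n; \<And>i. i < n \<Longrightarrow> i \<notin> S \<Longrightarrow> x $ i = 0; T *\<^sub>v x = 0\<^sub>v d\<rbrakk> \<Longrightarrow> x = 0\<^sub>v n"
proof -
  define R where "R S \<longleftrightarrow> S \<subseteq> {..<n} \<and> (\<exists>Y \<in> carrier_mat n d. T * Y = 1\<^sub>m d \<and>
    (\<forall>i<n. i \<notin> S \<longrightarrow> (\<forall>c<d. Y $$ (i, c) = 0)))" for S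
  have "R {..<n}" unfolding R_def using X TX by auto
  then obtain S where RS: "R S" and mn: "\<And>S'. R S' \<Longrightarrow> card S \<le> card S'"
    using ex_has_least_nat[of R "{..<n}" card] by blast
  obtain Y where S: "S \<subseteq> {..<n}" and Y: "Y \<in> carrier_mat n d" and TY: "T * Y = 1\<^sub>m d"
    and Y0: "\<And>i c. i < n \<Longrightarrow> i \<notin> S \<Longrightarrow> c < d \<Longrightarrow> Y $$ (i, c) = 0"
    using RS unfolding R_def by blast
  have finS: "finite S" using S finite_subset by blast
  have inj: "x = 0\<^sub>v n"
    if x: "x \<in> carrier_vec n" "\<And>i. i < n \<Longrightarrow> i \<notin> S \<Longrightarrow> x $ i = 0" "T *\<^sub>v x = 0\<^sub>v d" for x
  proof (rule ccontr)
    assume "x \<noteq> 0\<^sub>v n"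
    then obtain j where j: "j < n" "x $ j \<noteq> 0" using x(1) by (metis eq_vecI carrier_vecD index_zero_vec)
    then have jS: "j \<in> S" using x(2) by blast
    define Y' where "Y' = mat n d (\<lambda>(i, c). Y $$ (i, c) - x $ i * (Y $$ (j, c) / x $ j))"
    have Y': "Y' \<in> carrier_mat n d" by (simp add: Y'_def)
    have "T * Y' = 1\<^sub>m d"
    proof (rule eq_matI)
      fix a c assume "a < dim_row (1\<^sub>m d)" "c < dim_col (1\<^sub>m d)"
      then have ac: "a < d" "c < d" by auto
      have "(T * Y') $$ (a, c) = (\<Sum>k<n. T $$ (a, k) * Y' $$ (k, c))"
        by (rule index_mult_mat_sum[OF T Y' ac])
      also have "\<dots> = (\<Sum>k<n. T $$ (a, k) * Y $$ (k, c) -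
          (T $$ (a, k) * x $ k) * (Y $$ (j, c) / x $ j))"
        by (rule sum.cong) (use ac in \<open>auto simp: Y'_def algebra_simps\<close>)
      also have "\<dots> = (T * Y) $$ (a, c) - (T *\<^sub>v x) $ a * (Y $$ (j, c) / x $ j)"
        by (simp only: sum_subtractf sum_distrib_right index_mult_mat_sum[OF T Y ac]
            index_mult_mat_vec_sum[OF T x(1) ac(1)])
      finally show "(T * Y') $$ (a, c) = 1\<^sub>m d $$ (a, c)" using TY x(3) ac by simp
    qed (use T Y' in auto)
    then have "R (S - {j})" unfolding R_def using Y' S Y0 x(2) j
      by (auto intro!: bexI[of _ Y'] simp: Y'_def)
    then have "card S \<le> card (S - {j})" by (rule mn)
    then show False using card_Diff1_less[OF finS jS] by simp
  qed
  have diag: "(Y * T) $$ (i, i) = (if i \<in> S then 1 else 0)" if i: "i < n" for i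
  proof (cases "i \<in> S")
    case False
    then show ?thesis using i Y0 by (simp add: index_mult_mat_sum[OF Y T])
  next
    case True
    \<comment> \<open>\<open>x\<close> lies in the kernel of \<open>T\<close> because
      \<open>T * Y = 1\<close>, and it is supported on \<open>S\<close> because \<open>Y\<close> is
      and \<open>i \<in> S\<close>. So \<open>inj\<close> gives \<open>x = 0\<close>, that is,
      \<open>Y * T\<close> fixes the unit vector.\<close>
    define x where "x = Y *\<^sub>v (T *\<^sub>v unit_vec n i) - unit_vec n i"
    have Tu: "T *\<^sub>v unit_vec n i \<in> carrier_vec d" using T by simp
    have YTu: "Y *\<^sub>v (T *\<^sub>v unit_vec n i) \<in> carrier_vec n" using Y Tu by simp
    have x: "x \<in> carrier_vec n" using YTu by (simp add: x_def)
    have "T *\<^sub>v x = T *\<^sub>v (Y *\<^sub>v (T *\<^sub>v unit_vec n i)) - T *\<^sub>v unit_vec n i"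
      unfolding x_def using mult_minus_distrib_mat_vec[OF T YTu] by simp
    also have "T *\<^sub>v (Y *\<^sub>v (T *\<^sub>v unit_vec n i)) = T *\<^sub>v unit_vec n i"
      using assoc_mult_mat_vec[OF T Y Tu] Tu TY by simp
    finally have T0: "T *\<^sub>v x = 0\<^sub>v d" using Tu by simp
    have "x $ k = 0" if "k < n" "k \<notin> S" for k
      using that True i Y0 YTu
      by (auto simp: x_def index_mult_mat_vec_sum[OF Y Tu] simp del: index_mult_mat_vec)
    from inj[OF x this T0] have "x = 0\<^sub>v n" .
    then have "x $ i = 0" using i by simp
    then have "(Y *\<^sub>v (T *\<^sub>v unit_vec n i)) $ i = 1" unfolding x_def using YTu i by simp
    then have "((Y * T) *\<^sub>v unit_vec n i) $ i = 1"
      using assoc_mult_mat_vec[OF Y T, of "unit_vec n i"] i by simp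
    moreover have "Y * T \<in> carrier_mat n n" using Y T by simp
    ultimately have "(\<Sum>k<n. (Y * T) $$ (i, k) * unit_vec n i $ k) = 1"
      using index_mult_mat_vec_sum[of "Y * T" n n "unit_vec n i" i] i by simp
    also have "(\<Sum>k<n. (Y * T) $$ (i, k) * unit_vec n i $ k) =
        (\<Sum>k<n. if k = i then (Y * T) $$ (i, k) else 0)"
      by (rule sum.cong) (use i in auto)
    finally show ?thesis using True i by simp
  qed
  from card_eq_of_right_inverse[OF T Y TY S diag] inj show thesis using S that by blast
qed

section \<open>Coordinate subspaces and their projections\<close>

definition coord_subspace :: "nat \<Rightarrow> nat set \<Rightarrow> complex vec set" where
  "coord_subspace n S = {v \<in> carrier_vec n. \<forall>i<n. i \<notin> S \<longrightarrow> v $ i = 0}"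

lemma coord_subspace_subspace: "complex_subspace n (coord_subspace n S)"
proof -
  interpret cof_vec_space n "TYPE(complex)" .
  have "submodule class_ring (coord_subspace n S) V"
    by unfold_locales (auto simp: coord_subspace_def module_vec_simps)
  then show ?thesis unfolding VectorSpace.subspace_def using vectorspace_axioms by simp
qed

lemma orthonormal_basis_mat_row_in:
  assumes T: "orthonormal_basis_mat n U T" and U: "complex_subspace n U" and i: "i < dim_row T"
  shows "row T i \<in> U"
proof -
  interpret cof_vec_space n "TYPE(complex)" .
  interpret W: vectorspace class_ring "vs U" using subspace_is_vs U by auto
  have "set (rows T) \<subseteq> carrier (vs U)" using T unfolding orthonormal_basis_mat_def W.basis_def by blast
  then show ?thesis using i by (auto simp: rows_def)
qed

text \<open>The rows of \<open>T\<close> are fixed by right multiplication with the projection \<open>T\<^sup>* T\<close>, and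
  they span \<open>U\<close>.\<close>

lemma orthonormal_basis_mat_projection:
  assumes T: "orthonormal_basis_mat n U T" and U: "complex_subspace n U" and u: "u \<in> U"
  shows "transpose_mat (mat_adjoint T * T) *\<^sub>v u = u"
proof -
  interpret cof_vec_space n "TYPE(complex)" .
  interpret W: vectorspace class_ring "vs U" using subspace_is_vs U by auto
  have sm: "submodule class_ring U V" using U unfolding VectorSpace.subspace_def by auto
  let ?d = "subspace_dim n U" and ?P = "mat_adjoint T * T"
  have Tc: "T \<in> carrier_mat ?d n" using T unfolding orthonormal_basis_mat_def by auto
  have Ta: "mat_adjoint T \<in> carrier_mat n ?d" using Tc by simp
  have P: "?P \<in> carrier_mat n n" by (rule mult_carrier_mat[OF Ta Tc])
  have TP: "T * ?P = T"
    using assoc_mult_mat[OF Tc Ta Tc] orthonormal_basis_mat_coisometry[OF T] Tc by simp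
  \<comment> \<open>The transpose turns multiplication of a row by \<open>?P\<close> from the right
    into an action on column vectors. Since the fixed vectors form a submodule, it suffices to check
    the rows of \<open>T\<close>.\<close>
  let ?F = "{v \<in> carrier_vec n. transpose_mat ?P *\<^sub>v v = v}"
  have smF: "submodule class_ring ?F V"
  proof unfold_locales
    have Pt: "transpose_mat ?P \<in> carrier_mat n n" using P by simp
    show "?F \<subseteq> carrier V" by (auto simp: module_vec_simps)
    show "v \<oplus>\<^bsub>V\<^esub> w \<in> ?F" if "v \<in> ?F" "w \<in> ?F" for v w
      using that mult_add_distrib_mat_vec[OF Pt, of v w] by (simp add: module_vec_simps)
    show "\<zero>\<^bsub>V\<^esub> \<in> ?F" using mult_mat_vec[OF Pt, of "0\<^sub>v n" 0] Pt by (simp add: module_vec_simps)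
    show "c \<odot>\<^bsub>V\<^esub> v \<in> ?F" if "v \<in> ?F" for c v
      using that mult_mat_vec[OF Pt, of v c] by (simp add: module_vec_simps)
  qed
  have "set (rows T) \<subseteq> ?F"
  proof
    fix r assume "r \<in> set (rows T)"
    then obtain i where i: "i < ?d" and r: "r = row T i" using Tc by (auto simp: rows_def)
    have "transpose_mat ?P *\<^sub>v row T i = row (T * ?P) i"
    proof (rule eq_vecI)
      fix j assume "j < dim_vec (row (T * ?P) i)"
      then have j: "j < n" using carrier_matD[OF P] by simp
      have "row T i \<in> carrier_vec n" "col ?P j \<in> carrier_vec n" using i j Tc P by auto
      from comm_scalar_prod[OF this]
      show "(transpose_mat ?P *\<^sub>v row T i) $ j = row (T * ?P) i $ j"
        using i j carrier_matD[OF Tc] carrier_matD[OF P] by simp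
    qed (use carrier_matD[OF P] in simp)
    then show "r \<in> ?F" using r TP Tc i by simp
  qed
  then have "span (set (rows T)) \<subseteq> ?F" by (rule span_is_subset[OF _ smF])
  moreover have "W.basis (set (rows T))" using T unfolding orthonormal_basis_mat_def by blast
  then have bas: "set (rows T) \<subseteq> U" "W.span (set (rows T)) = U" unfolding W.basis_def by simp_all
  moreover have "W.span (set (rows T)) = span (set (rows T))"
    using span_li_not_depend(1)[OF bas(1) sm] by simp
  ultimately show ?thesis using u by auto
qed

text \<open>For \<open>i \<in> S\<close> the unit vector lies in the subspace and is fixed, which
  determines row \<open>i\<close> of the projection. For \<open>i \<notin> S\<close> column
  \<open>i\<close> of \<open>T\<close> vanishes, since all rows of \<open>T\<close> lie in the
  subspace.\<close>

lemma coord_subspace_projection: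
  assumes T: "orthonormal_basis_mat n (coord_subspace n S) T" and i: "i < n" and j: "j < n"
  shows "(mat_adjoint T * T) $$ (i, j) = (if i = j \<and> i \<in> S then 1 else 0)"
proof -
  let ?U = "coord_subspace n S"
  let ?d = "subspace_dim n ?U" and ?P = "mat_adjoint T * T"
  have Tc: "T \<in> carrier_mat ?d n" using T unfolding orthonormal_basis_mat_def by auto
  have Ta: "mat_adjoint T \<in> carrier_mat n ?d" using Tc by simp
  have P: "?P \<in> carrier_mat n n" by (rule mult_carrier_mat[OF Ta Tc])
  show ?thesis
  proof (cases "i \<in> S")
    case True
    then have "transpose_mat ?P *\<^sub>v unit_vec n i = unit_vec n i"
      by (intro orthonormal_basis_mat_projection[OF T coord_subspace_subspace])
        (auto simp: coord_subspace_def i)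
    then have "(transpose_mat ?P *\<^sub>v unit_vec n i) $ j = unit_vec n i $ j" by simp
    moreover have "(transpose_mat ?P *\<^sub>v unit_vec n i) $ j = (\<Sum>k<n. if k = i then ?P $$ (k, j) else 0)"
      unfolding index_mult_mat_vec_sum[OF transpose_carrier_mat[THEN iffD2, OF P] unit_vec_carrier j]
      by (rule sum.cong) (use i j carrier_matD[OF P] in auto)
    ultimately show ?thesis using True i j by auto
  next
    case False
    have "T $$ (a, i) = 0" if a: "a < ?d" for a
    proof -
      have "row T a \<in> ?U"
        using orthonormal_basis_mat_row_in[OF T coord_subspace_subspace] a Tc by simp
      then show ?thesis using False i a Tc by (simp add: coord_subspace_def)
    qed
    then show ?thesis using False i j
      by (simp add: index_mult_mat_sum[OF Ta Tc] index_mat_adjoint[OF Tc])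
  qed
qed

text \<open>The diagonal of the projection is the indicator of \<open>S\<close>, so comparing traces
  gives the dimension without an explicit basis.\<close>

lemma dim_coord_subspace:
  assumes S: "S \<subseteq> {..<n}"
  shows "subspace_dim n (coord_subspace n S) = card S"
proof -
  let ?U = "coord_subspace n S"
  obtain T where T: "orthonormal_basis_mat n ?U T"
    using orthonormal_basis_mat_exists[OF coord_subspace_subspace] by blast
  have Tc: "T \<in> carrier_mat (subspace_dim n ?U) n" using T unfolding orthonormal_basis_mat_def by auto
  show ?thesis
    using card_eq_of_right_inverse[OF Tc mat_adjoint_carrier[OF Tc]
        orthonormal_basis_mat_coisometry[OF T] S] coord_subspace_projection[OF T] by simp
qed

section \<open>From acyclic induced subgraphs to nil spaces\<close>

lemma acyclic_imp_nil:
  assumes E: "E \<subseteq> {..<n} \<times> {..<n}" and S: "S \<subseteq> {..<n}" and ac: "acyclic (induced_arcs E S)"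
  shows "nil_mat_space (induced_subspace n (graph_mat_space n E) (coord_subspace n S))"
  unfolding nil_mat_space_def
proof
  let ?U = "coord_subspace n S"
  let ?d = "subspace_dim n ?U" and ?r = "induced_arcs E S"
  define T where "T = onb_mat n ?U"
  have T: "orthonormal_basis_mat n ?U T"
    unfolding T_def by (rule onb_mat_orthonormal_basis[OF coord_subspace_subspace])
  have Tc: "T \<in> carrier_mat ?d n" using T unfolding orthonormal_basis_mat_def by auto
  have Ta: "mat_adjoint T \<in> carrier_mat n ?d" using Tc by simp
  let ?P = "mat_adjoint T * T"
  have P: "?P \<in> carrier_mat n n" by (rule mult_carrier_mat[OF Ta Tc])
  have TP: "T * ?P = T"
    using assoc_mult_mat[OF Tc Ta Tc] orthonormal_basis_mat_coisometry[OF T] Tc by simp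
  fix A assume "A \<in> induced_subspace n (graph_mat_space n E) ?U"
  then obtain B where A: "A = T * B * mat_adjoint T" and B: "B \<in> carrier_mat n n"
    and BE: "\<And>i j. i < n \<Longrightarrow> j < n \<Longrightarrow> (i, j) \<notin> E \<Longrightarrow> B $$ (i, j) = 0"
    unfolding induced_subspace_def T_def graph_mat_space_eq[OF E] by blast
  have Ac: "A \<in> carrier_mat ?d ?d" unfolding A by (rule mult_carrier_mat[OF mult_carrier_mat[OF Tc B] Ta])
  \<comment> \<open>Unlike \<open>A ^\<^sub>m m\<close>, this product has columns indexed by
    vertices. Multiplying by \<open>mat_adjoint T\<close> recovers the power.\<close>
  define N where "N m = A ^\<^sub>m m * T" for m
  have N: "N m \<in> carrier_mat ?d n" for m
    unfolding N_def using Ac Tc by (meson mult_carrier_mat pow_carrier_mat)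
  have colP: "(M * ?P) $$ (a, j) = (if j \<in> S then M $$ (a, j) else 0)"
    if M: "M \<in> carrier_mat ?d n" and aj: "a < ?d" "j < n" for M a j
  proof -
    have "(M * ?P) $$ (a, j) = (\<Sum>k<n. if k = j then (if j \<in> S then M $$ (a, j) else 0) else 0)"
      unfolding index_mult_mat_sum[OF M P aj]
      by (rule sum.cong) (use aj coord_subspace_projection[OF T] in auto)
    then show ?thesis using aj by simp
  qed
  have NP: "N m * ?P = N m" for m
    unfolding N_def using assoc_mult_mat[OF pow_carrier_mat[OF Ac] Tc P] TP by simp
  have N0: "N m $$ (a, j) = 0" if "a < ?d" "j < n" "j \<notin> S" for m a j
    using colP[OF N that(1,2), of m] that(3) NP by simp
  \<comment> \<open>Another factor \<open>A\<close> extends walks by one arc, with \<open>?P\<close>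
    discarding those that end outside \<open>S\<close>.\<close>
  have "N (Suc m) = N m * B * ?P" for m
  proof -
    have Am: "A ^\<^sub>m m \<in> carrier_mat ?d ?d" using Ac by simp
    have TB: "T * B \<in> carrier_mat ?d n" using Tc B by simp
    have "N (Suc m) = A ^\<^sub>m m * (A * T)" unfolding N_def using assoc_mult_mat[OF Am Ac Tc] by simp
    also have "A * T = T * B * ?P" unfolding A using assoc_mult_mat[OF TB Ta Tc] by simp
    also have "A ^\<^sub>m m * (T * B * ?P) = A ^\<^sub>m m * (T * B) * ?P"
      using assoc_mult_mat[OF Am TB P] by simp
    also have "A ^\<^sub>m m * (T * B) = N m * B" unfolding N_def using assoc_mult_mat[OF Am Tc B] by simp
    finally show ?thesis .
  qed
  then have step: "N (Suc m) $$ (a, j) = (\<Sum>i<n. N m $$ (a, i) * B $$ (i, j))"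
    if "a < ?d" "j < n" "j \<in> S" for m a j
    using that colP[of "N m * B" a j] N[of m] B index_mult_mat_sum[OF N B that(1,2), of m] by simp
  have finS: "finite S" using S finite_subset by blast
  have "finite ?r" by (rule finite_subset[of _ "S \<times> S"]) (use finS in \<open>auto simp: induced_arcs_def\<close>)
  then have wf: "wf ?r" using ac by (rule finite_acyclic_wf)
  have ex: "\<exists>M. \<forall>m\<ge>M. \<forall>a<?d. N m $$ (a, j) = 0" if "j < n" for j
    using wf that
  proof (induction j rule: wf_induct_rule)
    case (less j)
    show ?case
    proof (cases "j \<in> S")
      case False
      then show ?thesis using N0 less.prems by blast
    next
      case True
      \<comment> \<open>The implication stands inside the existential so that \<open>M\<close> is a
        total function; its value is arbitrary where there is no arc into \<open>j\<close>.\<close>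
      have "\<forall>i. \<exists>M. (i, j) \<in> ?r \<longrightarrow> (\<forall>m\<ge>M. \<forall>a<?d. N m $$ (a, i) = 0)"
        using less.IH S unfolding induced_arcs_def by blast
      then obtain M where M: "\<And>i m a. (i, j) \<in> ?r \<Longrightarrow> m \<ge> M i \<Longrightarrow> a < ?d \<Longrightarrow> N m $$ (a, i) = 0"
        by metis
      \<comment> \<open>The extra one pays for the last arc \<open>(i, j)\<close>. In each summand
        either \<open>i\<close> is a predecessor, already dealt with, or \<open>N\<close> or
        \<open>B\<close> has a zero entry.\<close>
      have "N m $$ (a, j) = 0" if m: "m \<ge> Suc (Max (M ` {..<n}))" and a: "a < ?d" for m a
      proof -
        obtain m' where m': "m = Suc m'" "m' \<ge> Max (M ` {..<n})" using m by (cases m) auto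
        have "N m' $$ (a, i) * B $$ (i, j) = 0" if i: "i < n" for i
        proof (cases "(i, j) \<in> E \<and> i \<in> S")
          case True
          then have "(i, j) \<in> ?r" using \<open>j \<in> S\<close> by (auto simp: induced_arcs_def)
          moreover have "M i \<le> m'" using i m'(2)
            by (meson Max_ge finite_imageI finite_lessThan image_eqI lessThan_iff order_trans)
          ultimately show ?thesis using M a by simp
        next
          case False
          then show ?thesis using N0[OF a i] BE[OF i less.prems] by auto
        qed
        then show ?thesis unfolding m' step[OF a less.prems True] by (intro sum.neutral) simp
      qed
      then show ?thesis by blast
    qed
  qed
  then obtain M where M: "\<And>j m a. j < n \<Longrightarrow> m \<ge> M j \<Longrightarrow> a < ?d \<Longrightarrow> N m $$ (a, j) = 0" by metis
  \<comment> \<open>One exponent serves all columns. For \<open>n = 0\<close> this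
    \<open>Max\<close> is unspecified, but there is no column to check.\<close>
  define m where "m = Max (M ` {..<n})"
  have "N m = 0\<^sub>m ?d n"
  proof (rule eq_matI)
    fix a j assume "a < dim_row (0\<^sub>m ?d n)" "j < dim_col (0\<^sub>m ?d n)"
    then have aj: "a < ?d" "j < n" by auto
    then have "M j \<le> m" unfolding m_def by simp
    then show "N m $$ (a, j) = 0\<^sub>m ?d n $$ (a, j)" using M aj by simp
  qed (use N[of m] in auto)
  moreover have "A ^\<^sub>m m = N m * mat_adjoint T"
    unfolding N_def using assoc_mult_mat[OF pow_carrier_mat[OF Ac] Tc Ta]
      orthonormal_basis_mat_coisometry[OF T] right_mult_one_mat[OF pow_carrier_mat[OF Ac]] by simp
  ultimately have "A ^\<^sub>m m = 0\<^sub>m ?d ?d" using Ta by simp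
  then show "nilpotent_mat A" unfolding nilpotent_mat_def using Ac by auto
qed

section \<open>From nil spaces to acyclic induced subgraphs\<close>

text \<open>Choose a successor map on the vertices lying on closed walks; a minimal nonempty set that it
  maps into itself is permuted.\<close>

lemma not_acyclic_permuted_set:
  assumes fin: "finite r" and nac: "\<not> acyclic r"
  shows "\<exists>D f. D \<noteq> {} \<and> f ` D = D \<and> (\<forall>i\<in>D. (i, f i) \<in> r)"
proof -
  define C where "C = {y. (y, y) \<in> r\<^sup>+}"
  \<comment> \<open>The second vertex of a closed walk through \<open>y\<close> lies on the same
    closed walk.\<close>
  have "\<exists>z. (y, z) \<in> r \<and> z \<in> C" if "y \<in> C" for y
    using that unfolding C_def by (auto dest!: tranclD intro: rtrancl_into_trancl1)
  then obtain f where f: "\<And>y. y \<in> C \<Longrightarrow> (y, f y) \<in> r \<and> f y \<in> C" by metis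
  have "C \<subseteq> fst ` r" using f by force
  then have finC: "finite C" using fin finite_subset by blast
  let ?Q = "\<lambda>D. D \<subseteq> C \<and> D \<noteq> {} \<and> f ` D \<subseteq> D"
  have "?Q C" using f nac unfolding acyclic_def C_def by auto
  then obtain D where D: "?Q D" and mn: "\<And>D'. ?Q D' \<Longrightarrow> card D \<le> card D'"
    using ex_has_least_nat[of ?Q C card] by blast
  have finD: "finite D" using D finC finite_subset by blast
  have "?Q (f ` D)" using D by blast
  then have "f ` D = D" using mn[of "f ` D"] D finD by (meson card_seteq)
  moreover have "\<forall>i\<in>D. (i, f i) \<in> r" using D f by blast
  ultimately show ?thesis using D by (intro exI[of _ D] exI[of _ f]) simp
qed

text \<open>The assumption \<open>inj\<close> supplies the positive definiteness of the Gram matrix,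
  for the columns in \<open>S\<close> and hence for those in any subset \<open>D\<close>.\<close>

lemma nil_imp_acyclic:
  assumes E: "E \<subseteq> {..<n} \<times> {..<n}" and T: "T \<in> carrier_mat d n"
    and nil: "\<And>B. B \<in> graph_mat_space n E \<Longrightarrow> nilpotent_mat (T * B * mat_adjoint T)"
    and S: "S \<subseteq> {..<n}"
    and inj: "\<And>x. \<lbrakk>x \<in> carrier_vec n; \<And>i. i < n \<Longrightarrow> i \<notin> S \<Longrightarrow> x $ i = 0; T *\<^sub>v x = 0\<^sub>v d\<rbrakk> \<Longrightarrow> x = 0\<^sub>v n"
  shows "acyclic (induced_arcs E S)"
proof (rule ccontr)
  assume nac: "\<not> acyclic (induced_arcs E S)"
  have "finite (induced_arcs E S)"
    by (rule finite_subset[of _ "{..<n} \<times> {..<n}"]) (use S in \<open>auto simp: induced_arcs_def\<close>)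
  from not_acyclic_permuted_set[OF this nac]
  obtain D f where D: "D \<noteq> {}" "f ` D = D" and "\<forall>i\<in>D. (i, f i) \<in> induced_arcs E S"
    by (elim exE conjE)
  then have arc: "\<And>i. i \<in> D \<Longrightarrow> (i, f i) \<in> induced_arcs E S" by simp
  have DS: "D \<subseteq> S" using arc by (auto simp: induced_arcs_def)
  then have Dn: "D \<subseteq> {..<n}" using S by blast
  define X :: "complex mat" where "X = mat n n (\<lambda>(i, j). if i \<in> D \<and> j = f i then 1 else 0)"
  have X: "X \<in> carrier_mat n n" by (simp add: X_def)
  have "X \<in> graph_mat_space n E"
    unfolding graph_mat_space_eq[OF E] using arc by (auto simp: X_def induced_arcs_def)
  define A where "A = T * X * mat_adjoint T"
  have Ta: "mat_adjoint T \<in> carrier_mat n d" using T by simp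
  have A: "A \<in> carrier_mat d d" unfolding A_def by (rule mult_carrier_mat[OF mult_carrier_mat[OF T X] Ta])
  have Xz: "(X *\<^sub>v z) $ i = (if i \<in> D then z $ f i else 0)" if z: "z \<in> carrier_vec n" and i: "i < n" for z i
  proof -
    have "(X *\<^sub>v z) $ i = (\<Sum>k<n. if k = f i then (if i \<in> D then z $ f i else 0) else 0)"
      unfolding index_mult_mat_vec_sum[OF X z i] by (rule sum.cong) (use i in \<open>auto simp: X_def\<close>)
    moreover have "f i < n" if "i \<in> D" using that D Dn by blast
    ultimately show ?thesis by auto
  qed
  \<comment> \<open>The images under \<open>T\<close> of these vectors are nonzero by
    \<open>inj\<close>, and \<open>A\<close> maps them to images of the same kind. This invariant
    excludes nilpotency.\<close>
  let ?W = "{x \<in> carrier_vec n. x \<noteq> 0\<^sub>v n \<and> (\<forall>i<n. i \<notin> D \<longrightarrow> x $ i = 0)}"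
  have step: "\<exists>y \<in> ?W. A *\<^sub>v (T *\<^sub>v x) = T *\<^sub>v y" if x: "x \<in> ?W" for x
  proof -
    have xc: "x \<in> carrier_vec n" using x by blast
    define u where "u = T *\<^sub>v x"
    have u: "u \<in> carrier_vec d" unfolding u_def using T xc by simp
    define z where "z = mat_adjoint T *\<^sub>v u"
    have z: "z \<in> carrier_vec n" unfolding z_def using Ta u by simp
    have Tx: "T * X \<in> carrier_mat d n" using T X by simp
    have eq: "A *\<^sub>v u = T *\<^sub>v (X *\<^sub>v z)"
      unfolding A_def z_def using assoc_mult_mat_vec[OF Tx Ta u] assoc_mult_mat_vec[OF T X] z
      by (simp add: z_def)
    have "X *\<^sub>v z \<noteq> 0\<^sub>v n"
    proof
      \<comment> \<open>\<open>X\<close> reads \<open>z\<close> at the points \<open>f i\<close>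
        with \<open>i \<in> D\<close>, and these exhaust \<open>D\<close>; so \<open>z\<close>
        vanishes on \<open>D\<close>.\<close>
      assume X0: "X *\<^sub>v z = 0\<^sub>v n"
      have z0: "z $ j = 0" if "j \<in> D" for j
      proof -
        have "j \<in> f ` D" unfolding D(2) by (rule that)
        then obtain i where i: "j = f i" "i \<in> D" by (rule imageE)
        then have "i < n" using Dn by blast
        then show ?thesis using Xz[OF z, of i] i unfolding X0 by simp
      qed
      \<comment> \<open>Expanding the conjugated factor \<open>u = T x\<close> turns the squared
        norm into the pairing of \<open>z\<close> with \<open>x\<close>. It is zero since
        \<open>z\<close> vanishes on \<open>D\<close> and \<open>x\<close> off
        \<open>D\<close>.\<close>
      have "u \<bullet>c u = (\<Sum>a<d. u $ a * conjugate (u $ a))"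
        using u by (auto simp: scalar_prod_def atLeast0LessThan intro!: sum.cong)
      also have "\<dots> = (\<Sum>a<d. \<Sum>j<n. conjugate (x $ j) * (conjugate (T $$ (a, j)) * u $ a))"
        by (rule sum.cong) (auto simp: u_def index_mult_mat_vec_sum[OF T xc] sum_distrib_left
            sum_distrib_right sum_conjugate conjugate_dist_mul mult_ac simp del: index_mult_mat_vec)
      also have "\<dots> = (\<Sum>j<n. conjugate (x $ j) * z $ j)"
        unfolding z_def by (subst sum.swap, rule sum.cong)
          (auto simp: index_mult_mat_vec_sum[OF Ta u] index_mat_adjoint[OF T] sum_distrib_left
            simp del: index_mult_mat_vec)
      also have "\<dots> = 0"
        using z0 x by (intro sum.neutral) fastforce
      finally have "u = 0\<^sub>v d" using conjugate_square_eq_0_vec[OF u] by simp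
      then have "x = 0\<^sub>v n" using inj[OF xc] x DS unfolding u_def by blast
      then show False using x by blast
    qed
    moreover have "X *\<^sub>v z \<in> carrier_vec n" using X z by simp
    ultimately have "X *\<^sub>v z \<in> ?W" using Xz[OF z] by simp
    then show ?thesis using eq unfolding u_def by blast
  qed
  \<comment> \<open>\<open>x\<close> is generalized because each application of \<open>A\<close>
    replaces it by another member of \<open>?W\<close>.\<close>
  have pow: "A ^\<^sub>m m *\<^sub>v (T *\<^sub>v x) \<noteq> 0\<^sub>v d" if "x \<in> ?W" for m x
    using that
  proof (induction m arbitrary: x)
    case 0
    have "T *\<^sub>v x \<in> carrier_vec d" using T 0 by simp
    then show ?case using 0 inj[of x] DS A by auto
  next
    case (Suc m)
    obtain y where y: "y \<in> ?W" "A *\<^sub>v (T *\<^sub>v x) = T *\<^sub>v y" using step Suc.prems by blast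
    have Tx: "T *\<^sub>v x \<in> carrier_vec d" using T Suc.prems by simp
    have "A ^\<^sub>m Suc m *\<^sub>v (T *\<^sub>v x) = A ^\<^sub>m m *\<^sub>v (T *\<^sub>v y)"
      using assoc_mult_mat_vec[OF pow_carrier_mat[OF A] A Tx] y(2) by simp
    then show ?case using Suc.IH[OF y(1)] by simp
  qed
  obtain i where i: "i \<in> D" using D by blast
  then have "i < n" using Dn by blast
  then have W: "unit_vec n i \<in> ?W" using i by auto
  obtain k where "A ^\<^sub>m k = 0\<^sub>m d d"
    using nil[OF \<open>X \<in> graph_mat_space n E\<close>] A unfolding nilpotent_mat_def A_def[symmetric] by auto
  moreover have "0\<^sub>m d d *\<^sub>v (T *\<^sub>v unit_vec n i) = 0\<^sub>v d"
    by (rule eq_vecI) (use T in \<open>auto simp: scalar_prod_def\<close>)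
  ultimately show False using pow[OF W, of k] by simp
qed

theorem theorem1p11:
  fixes n :: nat and E :: "(nat \<times> nat) set"
  assumes "E \<subseteq> {..<n} \<times> {..<n}"
  shows "Max {card S | S. S \<subseteq> {..<n} \<and> acyclic (induced_arcs E S)} =
    Max {subspace_dim n U | U. complex_subspace n U \<and>
      nil_mat_space (induced_subspace n (graph_mat_space n E) U)}"
proof -
  have "\<exists>U. card S = subspace_dim n U \<and> complex_subspace n U \<and>
      nil_mat_space (induced_subspace n (graph_mat_space n E) U)"
    if "S \<subseteq> {..<n}" "acyclic (induced_arcs E S)" for S
    using dim_coord_subspace[OF that(1)] coord_subspace_subspace[of n S]
      acyclic_imp_nil[OF assms that] by metis
  moreover have "\<exists>S. subspace_dim n U = card S \<and> S \<subseteq> {..<n} \<and> acyclic (induced_arcs E S)"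
    if U: "complex_subspace n U"
      and nil: "nil_mat_space (induced_subspace n (graph_mat_space n E) U)" for U
  proof -
    define T where "T = onb_mat n U"
    have onb: "orthonormal_basis_mat n U T" unfolding T_def by (rule onb_mat_orthonormal_basis[OF U])
    then have T: "T \<in> carrier_mat (subspace_dim n U) n" unfolding orthonormal_basis_mat_def by auto
    obtain S where S: "S \<subseteq> {..<n}" "card S = subspace_dim n U"
      and inj: "\<And>x. \<lbrakk>x \<in> carrier_vec n; \<And>i. i < n \<Longrightarrow> i \<notin> S \<Longrightarrow> x $ i = 0;
        T *\<^sub>v x = 0\<^sub>v (subspace_dim n U)\<rbrakk> \<Longrightarrow> x = 0\<^sub>v n"
      using independent_columns_of_right_inverse[OF T mat_adjoint_carrier[OF T]
          orthonormal_basis_mat_coisometry[OF onb]] by blast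
    have "nilpotent_mat (T * B * mat_adjoint T)" if "B \<in> graph_mat_space n E" for B
      using nil that unfolding nil_mat_space_def induced_subspace_def T_def by blast
    from nil_imp_acyclic[OF assms T this S(1) inj] S show ?thesis by metis
  qed
  \<comment> \<open>Both constructions preserve the size exactly, so the two sets of attained values
    coincide, and with them their maxima.\<close>
  ultimately have "{card S | S. S \<subseteq> {..<n} \<and> acyclic (induced_arcs E S)} =
    {subspace_dim n U | U. complex_subspace n U \<and>
      nil_mat_space (induced_subspace n (graph_mat_space n E) U)}"
    by (intro equalityI subsetI) blast+
  then show ?thesis by simp
qed

end
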